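(* Let $\mathcal{H}$ be a complex Hilbert space, let $A\in\mathcal{B}(\mathcal{H})$ be a positive operator, and let $T,S\in\mathcal{B}_A(\mathcal{H})$. Then, for each choice of the sign $\pm$, (i) $$w_A(TS\pm ST)\leq 2\sqrt{2}\,\|S\|_A\sqrt{w_A^2(T)-\frac{\big|\,\|\Re_A(T)\|_A^2-\|\Im_A(T)\|_A^2\,\big|}{2}},$$ and (ii) $$w_A(TS\pm ST)\leq 2\sqrt{2}\,\|S\|_A\sqrt{w_A^2(T)-\frac{\big|\,\|\Re_A(T)+\Im_A(T)\|_A^2-\|\Re_A(T)-\Im_A(T)\|_A^2\,\big|}{4}}.$$
   Context: $\mathcal{B}(\mathcal{H})$ is the algebra of bounded linear operators on the complex Hilbert space $\mathcal{H}$ with inner product $\langle\cdot,\cdot\rangle$; $A\in\mathcal{B}(\mathcal{H})$ is positive (i.e. $\langle Ax,x\rangle\ge 0$ for all $x$), not necessarily injective. Put $\langle x,y\rangle_A=\langle Ax,y\rangle$ and $\|x\|_A=\sqrt{\langle x,x\rangle_A}$ (a seminorm on $\mathcal{H}$). $R(S)$ denotes the range of $S$ and $\overline{R(S)}$ its norm closure. $\mathcal{B}_A(\mathcal{H})=\{T\in\mathcal{B}(\mathcal{H}): R(T^*A)\subseteq R(A)\}$, equivalently the set of $T\in\mathcal{B}(\mathcal{H})$ for which there is $S\in\mathcal{B}(\mathcal{H})$ with $AS=T^*A$; it is a subalgebra of $\mathcal{B}(\mathcal{H})$. For $T\in\mathcal{B}_A(\mathcal{H})$, $T^{\sharp_A}$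 denotes the unique $X\in\mathcal{B}(\mathcal{H})$ with $AX=T^*A$ and $R(X)\subseteq\overline{R(A)}$. For $T\in\mathcal{B}_A(\mathcal{H})$: $\|T\|_A=\sup\{\|Tx\|_A: x\in\overline{R(A)},\ \|x\|_A=1\}=\sup\{\|Tx\|_A: x\in\mathcal{H},\ \|x\|_A=1\}$ (finite), and $w_A(T)=\sup\{|\langle Tx,x\rangle_A|: x\in\mathcal{H},\ \|x\|_A=1\}$; $w_A^2(T)$ means $(w_A(T))^2$. Finally $\Re_A(T)=\frac{T+T^{\sharp_A}}{2}$ and $\Im_A(T)=\frac{T-T^{\sharp_A}}{2\mathrm{i}}$. *)

theory Defs
  imports "HOL-Analysis.Analysis"
begin

text \<open>
  A complex inner product space is presented as a real inner product space whose real inner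
  product is the real part of a sesquilinear form (linear in the first argument). Positive
  definiteness of \<open>cinner\<close>, and the fact that \<open>norm x\<close> is the square root of \<open>cinner x x\<close>, are
  inherited from \<^class>\<open>real_inner\<close>, since \<open>cinner x x\<close> is real by conjugate symmetry.
\<close>

class complex_inner = real_inner +
  fixes scaleC :: "complex \<Rightarrow> 'a \<Rightarrow> 'a" (infixr "*\<^sub>C" 75)
    and cinner :: "'a \<Rightarrow> 'a \<Rightarrow> complex"
  assumes scaleC_add_right: "c *\<^sub>C (x + y) = c *\<^sub>C x + c *\<^sub>C y"
    and scaleC_add_left: "(c + d) *\<^sub>C x = c *\<^sub>C x + d *\<^sub>C x"
    and scaleC_scaleC: "c *\<^sub>C (d *\<^sub>C x) = (c * d) *\<^sub>C x"
    and scaleR_scaleC: "r *\<^sub>R x = complex_of_real r *\<^sub>C x"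
    and cinner_commute: "cinner x y = cnj (cinner y x)"
    and cinner_add_left: "cinner (x + y) z = cinner x z + cinner y z"
    and cinner_scaleC_left: "cinner (c *\<^sub>C x) y = c * cinner x y"
    and inner_eq_Re_cinner: "inner x y = Re (cinner x y)"

class chilbert_space = complex_inner + complete_space

instantiation complex :: chilbert_space
begin
definition scaleC_complex :: "complex \<Rightarrow> complex \<Rightarrow> complex"
  where "scaleC_complex c x = c * x"
definition cinner_complex :: "complex \<Rightarrow> complex \<Rightarrow> complex"
  where "cinner_complex x y = x * cnj y"
instance
  by standard
    (simp_all add: scaleC_complex_def cinner_complex_def algebra_simps scaleR_conv_of_real
      inner_complex_def)
end

definition bounded_ops :: "('h::chilbert_space \<Rightarrow> 'h) set"
  where "bounded_ops = {T. bounded_linear T \<and> (\<forall>c x. T (c *\<^sub>C x) = c *\<^sub>C T x)}"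

definition positive_op :: "('h::chilbert_space \<Rightarrow> 'h) \<Rightarrow> bool"
  where "positive_op A \<longleftrightarrow> A \<in> bounded_ops \<and> (\<forall>x. cinner (A x) x \<in> \<real>\<^sub>\<ge>\<^sub>0)"

definition cadjoint :: "('h::chilbert_space \<Rightarrow> 'h) \<Rightarrow> 'h \<Rightarrow> 'h"
  where "cadjoint T =
    (THE T'. T' \<in> bounded_ops \<and> (\<forall>x y. cinner (T x) y = cinner x (T' y)))"

definition A_inner :: "('h::chilbert_space \<Rightarrow> 'h) \<Rightarrow> 'h \<Rightarrow> 'h \<Rightarrow> complex"
  where "A_inner A x y = cinner (A x) y"

definition A_norm :: "('h::chilbert_space \<Rightarrow> 'h) \<Rightarrow> 'h \<Rightarrow> real"
  where "A_norm A x = sqrt (Re (A_inner A x x))"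

definition A_adjointable :: "('h::chilbert_space \<Rightarrow> 'h) \<Rightarrow> ('h \<Rightarrow> 'h) set"
  where "A_adjointable A = {T \<in> bounded_ops. range (cadjoint T \<circ> A) \<subseteq> range A}"

definition A_adj :: "('h::chilbert_space \<Rightarrow> 'h) \<Rightarrow> ('h \<Rightarrow> 'h) \<Rightarrow> 'h \<Rightarrow> 'h"
  where "A_adj A T =
    (THE X. X \<in> bounded_ops \<and> A \<circ> X = cadjoint T \<circ> A \<and> range X \<subseteq> closure (range A))"

text \<open>
  The suprema below are taken in \<open>[0, \<infinity>)\<close>. Inserting \<open>0\<close> matters only when no vector has
  \<open>A\<close>-seminorm one, i.e. when \<open>A = 0\<close>: then the supremum is \<open>0\<close>, whereas \<open>Sup {}\<close> is
  unspecified on the reals.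
\<close>

definition A_opnorm :: "('h::chilbert_space \<Rightarrow> 'h) \<Rightarrow> ('h \<Rightarrow> 'h) \<Rightarrow> real"
  where "A_opnorm A T = Sup (insert 0 {A_norm A (T x) | x. A_norm A x = 1})"

definition A_numradius :: "('h::chilbert_space \<Rightarrow> 'h) \<Rightarrow> ('h \<Rightarrow> 'h) \<Rightarrow> real"
  where "A_numradius A T = Sup (insert 0 {cmod (A_inner A (T x) x) | x. A_norm A x = 1})"

definition A_Re :: "('h::chilbert_space \<Rightarrow> 'h) \<Rightarrow> ('h \<Rightarrow> 'h) \<Rightarrow> 'h \<Rightarrow> 'h"
  where "A_Re A T = (\<lambda>x. (1 / 2) *\<^sub>C (T x + A_adj A T x))"

definition A_Im :: "('h::chilbert_space \<Rightarrow> 'h) \<Rightarrow> ('h \<Rightarrow> 'h) \<Rightarrow> 'h \<Rightarrow> 'h"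
  where "A_Im A T = (\<lambda>x. (1 / (2 * \<i>)) *\<^sub>C (T x - A_adj A T x))"

end

theory Submission imports Defs begin

text \<open>
  Write \<open>T = P + \<i>Q\<close> with \<open>P = \<Re>\<^sub>A(T)\<close>, \<open>Q = \<Im>\<^sub>A(T)\<close>, both symmetric for
  \<open>\<langle>\<cdot>,\<cdot>\<rangle>\<^sub>A\<close>. Moving one factor to the other side of \<open>\<langle>\<cdot>,\<cdot>\<rangle>\<^sub>A\<close> bounds
  \<open>\<bar>\<langle>(TS \<plusminus> ST)x, x\<rangle>\<^sub>A\<bar>\<close> by \<open>\<parallel>S\<parallel>\<^sub>A (\<parallel>Tx\<parallel>\<^sub>A + \<parallel>T\<^sup>\<sharp>x\<parallel>\<^sub>A)\<close>, and
  \<open>\<parallel>Tx\<parallel>\<^sub>A\<^sup>2 + \<parallel>T\<^sup>\<sharp>x\<parallel>\<^sub>A\<^sup>2\<close> equals both \<open>2(\<parallel>Px\<parallel>\<^sub>A\<^sup>2 + \<parallel>Qx\<parallel>\<^sub>A\<^sup>2)\<close> and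
  \<open>\<parallel>(P + Q)x\<parallel>\<^sub>A\<^sup>2 + \<parallel>(P - Q)x\<parallel>\<^sub>A\<^sup>2\<close>. A symmetric operator has \<open>A\<close>-norm equal to its
  \<open>A\<close>-numerical radius, so \<open>P\<close> and \<open>Q\<close> have norm at most \<open>w\<^sub>A(T)\<close> and \<open>P \<plusminus> Q\<close> at most
  \<open>\<surd>2 w\<^sub>A(T)\<close>; finally \<open>a + b = 2 max a b - \<bar>a - b\<bar>\<close>.

  The existence of \<open>T\<^sup>\<sharp>\<close> as a bounded operator rests on Riesz representation and the Baire
  category theorem, the finiteness of \<open>\<parallel>T\<parallel>\<^sub>A\<close> on Krein's log-convexity argument.
\<close>

section \<open>Hilbert space preliminaries\<close>

text \<open>First-order optimality condition: a nonzero linear term dominates near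
  \<open>t = 0\<close>. The witness \<open>- b / (c + 1)\<close> has \<open>c + 1\<close> in place
  of \<open>c\<close> so that \<open>c = 0\<close> is covered. It serves the minimiser in the Riesz
  argument and Cauchy-Schwarz on null vectors.\<close>

lemma quadratic_nonneg_imp_linear_zero:
  fixes b c :: real
  assumes "\<And>t. 0 \<le> t\<^sup>2 * c + 2 * t * b" and "0 \<le> c"
  shows "b = 0"
proof (rule ccontr)
  assume "b \<noteq> 0"
  define t where "t = - b / (c + 1)"
  have b: "b = - t * (c + 1)" using \<open>0 \<le> c\<close> by (simp add: t_def)
  then have "t \<noteq> 0" using \<open>b \<noteq> 0\<close> by auto
  have "t\<^sup>2 * c + 2 * t * b = - (t\<^sup>2 * (c + 2))"
    unfolding b by (simp add: algebra_simps power2_eq_square)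
  moreover have "t\<^sup>2 * (c + 2) > 0" using \<open>t \<noteq> 0\<close> \<open>0 \<le> c\<close> by simp
  ultimately show False using assms(1)[of t] by linarith
qed

text \<open>The representing vector is the minimiser of \<open>\<parallel>x\<parallel>\<^sup>2 - 2 f x\<close> on \<open>V\<close>.\<close>

lemma riesz_representation_on_subspace:
  fixes f :: "'a::{real_inner,complete_space} \<Rightarrow> real"
  assumes f: "bounded_linear f" and V: "subspace V" "closed V"
  obtains a where "a \<in> V" and "\<And>v. v \<in> V \<Longrightarrow> f v = inner a v"
proof -
  interpret f: bounded_linear f by (rule f)
  define \<phi> where "\<phi> x = (norm x)\<^sup>2 - 2 * f x" for x
  obtain K where K: "\<And>x. norm (f x) \<le> norm x * K" using f.bounded by blast
  have low: "- K\<^sup>2 \<le> \<phi> x" for x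
  proof -
    have "f x \<le> norm x * K" using K[of x] by auto
    moreover have "0 \<le> (norm x - K)\<^sup>2" by simp
    ultimately show ?thesis unfolding \<phi>_def power2_diff by (simp add: mult.commute)
  qed
  define m where "m = Inf (\<phi> ` V)"
  have bdd: "bdd_below (\<phi> ` V)" using low by (auto intro!: bdd_belowI)
  have m: "m \<le> \<phi> x" if "x \<in> V" for x
    unfolding m_def by (rule cInf_lower) (use that bdd in auto)
  have "\<exists>x\<in>V. \<phi> x < m + inverse (Suc n)" for n
  proof -
    have "\<phi> ` V \<noteq> {}" using subspace_0[OF V(1)] by auto
    moreover have "Inf (\<phi> ` V) < m + inverse (real (Suc n))" by (simp add: m_def)
    ultimately have "\<exists>y\<in>\<phi> ` V. y < m + inverse (real (Suc n))" by (rule cInf_lessD)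
    then show ?thesis by auto
  qed
  then obtain x where xV: "\<And>n. x n \<in> V" and x: "\<And>n. \<phi> (x n) < m + inverse (real (Suc n))"
    by metis
  \<comment> \<open>Parallelogram law with \<open>\<phi>\<close> in place of the squared norm: the
    linear terms \<open>f u\<close> and \<open>f v\<close> cancel. Since \<phi> at the midpoint is
    at least \<open>m\<close>, minimising sequences are Cauchy.\<close>
  have par: "(norm (u - v))\<^sup>2 = 2 * \<phi> u + 2 * \<phi> v - 4 * \<phi> ((1 / 2) *\<^sub>R (u + v))" for u v
    unfolding \<phi>_def by (simp add: power2_norm_eq_inner f.scaleR f.add algebra_simps inner_commute)
  have mid: "(1 / 2) *\<^sub>R (u + v) \<in> V" if "u \<in> V" "v \<in> V" for u v
    by (intro subspace_add subspace_scale V(1) that)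
  have dist: "(norm (x i - x j))\<^sup>2 \<le> 2 * inverse (real (Suc i)) + 2 * inverse (real (Suc j))" for i j
    using par[of "x i" "x j"] m[OF mid[OF xV xV], of i j] x[of i] x[of j] by linarith
  have "Cauchy x"
  proof (rule metric_CauchyI)
    fix e :: real assume "0 < e"
    obtain N where N: "inverse (real (Suc N)) < e\<^sup>2 / 4"
      using reals_Archimedean[of "e\<^sup>2 / 4"] \<open>0 < e\<close> by auto
    have "dist (x i) (x j) < e" if "N \<le> i" "N \<le> j" for i j
    proof -
      have "inverse (real (Suc i)) \<le> inverse (real (Suc N))"
        "inverse (real (Suc j)) \<le> inverse (real (Suc N))"
        using that by (auto intro!: le_imp_inverse_le)
      then have "(norm (x i - x j))\<^sup>2 < e\<^sup>2" using dist[of i j] N by linarith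
      then show ?thesis using \<open>0 < e\<close> by (simp add: dist_norm power_less_imp_less_base)
    qed
    then show "\<exists>M. \<forall>i\<ge>M. \<forall>j\<ge>M. dist (x i) (x j) < e" by blast
  qed
  then obtain a where a: "x \<longlonglongrightarrow> a" using Cauchy_convergent convergent_def by blast
  have aV: "a \<in> V" using V(2) xV a closed_sequentially by blast
  have "(\<lambda>n. \<phi> (x n)) \<longlonglongrightarrow> \<phi> a"
    unfolding \<phi>_def by (intro tendsto_intros f.tendsto a)
  moreover have "(\<lambda>n. m + inverse (real (Suc n))) \<longlonglongrightarrow> m + 0"
    by (intro tendsto_intros LIMSEQ_inverse_real_of_nat)
  ultimately have "\<phi> a \<le> m + 0"
    by (rule LIMSEQ_le) (use x less_imp_le in blast)
  have "f v = inner a v" if v: "v \<in> V" for v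
  proof -
    have "inner a v - f v = 0"
    proof (rule quadratic_nonneg_imp_linear_zero[where c = "inner v v"])
      fix t
      have "a + t *\<^sub>R v \<in> V" by (intro subspace_add subspace_scale V(1) aV v)
      from m[OF this] have "\<phi> a \<le> \<phi> (a + t *\<^sub>R v)" using \<open>\<phi> a \<le> m + 0\<close> by simp
      \<comment> \<open>Varying the minimiser \<open>a\<close> in the direction \<open>v\<close>
        makes \<open>inner a v - f v\<close> the linear coefficient in \<open>t\<close>.\<close>
      also have "\<phi> (a + t *\<^sub>R v) = \<phi> a + (t\<^sup>2 * inner v v + 2 * t * (inner a v - f v))"
        unfolding \<phi>_def power2_norm_eq_inner power2_eq_square[of t]
        by (simp add: f.scaleR f.add algebra_simps inner_commute)
      finally show "0 \<le> t\<^sup>2 * inner v v + 2 * t * (inner a v - f v)" by simp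
    qed simp
    then show ?thesis by simp
  qed
  with aV show ?thesis by (rule that)
qed

text \<open>The sublevel sets cover the complete space, so by Baire one of them contains a ball.
  Subtracting its centre turns the bound on that ball into a bound around the origin.\<close>

lemma linear_bounded_if_sublevels_closed:
  fixes f :: "'a::{real_normed_vector,complete_space} \<Rightarrow> 'b::real_normed_vector"
  assumes f: "linear f" and cl: "\<And>n::nat. closed {x. norm (f x) \<le> n}"
  shows "bounded_linear f"
proof -
  interpret f: linear f by (rule f)
  let ?E = "\<lambda>n::nat. {x. norm (f x) \<le> n}"
  have "\<Union>(range ?E) = UNIV"
    using real_arch_simple by auto
  then have "interior (\<Union>(range ?E)) \<noteq> {}" by simp
  then obtain n where "interior (?E n) \<noteq> {}"
    using Baire_category_alt[of euclidean "range ?E"] cl completely_metrizable_space_euclidean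
    by (auto simp: euclidean_interior_of)
  then obtain c where "c \<in> interior (?E n)" by blast
  then obtain e where "e > 0" and e: "cball c e \<subseteq> ?E n"
    by (meson mem_interior_cball)
  \<comment> \<open>Scaling \<open>x\<close> to length \<open>e\<close> keeps \<open>c + y\<close>
    in the ball. The factor 2 arises because \<open>f y\<close> is a difference of two values of
    norm at most \<open>n\<close>.\<close>
  have "norm (f x) \<le> norm x * (2 * n / e)" for x
  proof (cases "x = 0")
    case False
    define y where "y = (e / norm x) *\<^sub>R x"
    have "norm y = e" using False \<open>e > 0\<close> by (simp add: y_def)
    then have "c + y \<in> cball c e" "c \<in> cball c e" using \<open>e > 0\<close> by (auto simp: dist_norm)
    then have "c + y \<in> ?E n" "c \<in> ?E n" using e by blast+
    then have "norm (f (c + y) - f c) \<le> n + n" using norm_triangle_ineq4[of "f (c + y)" "f c"] by simp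
    also have "f (c + y) - f c = (e / norm x) *\<^sub>R f x" by (simp add: f.add y_def f.scaleR)
    finally show ?thesis using \<open>e > 0\<close> False by (simp add: field_simps)
  qed (simp add: f.zero)
  then show ?thesis using f unfolding bounded_linear_def bounded_linear_axioms_def by blast
qed

section \<open>Algebra of the complex inner product and of bounded operators\<close>

lemma cinner_add_right: "cinner x (y + z) = cinner x y + cinner x (z :: 'a::complex_inner)"
  by (subst (1 2 3) cinner_commute) (simp add: cinner_add_left)

lemma cinner_scaleC_right: "cinner x (c *\<^sub>C y) = cnj c * cinner x (y :: 'a::complex_inner)"
  by (subst (1 2) cinner_commute) (simp add: cinner_scaleC_left)

lemma scaleC_minus_one: "(- 1) *\<^sub>C (x :: 'a::complex_inner) = - x"
  using scaleR_scaleC[of "-1" x] by simp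

lemma scaleC_one: "1 *\<^sub>C (x :: 'a::complex_inner) = x"
  using scaleR_scaleC[of 1 x] by simp

lemma cinner_minus_left: "cinner (- x) y = - cinner x (y :: 'a::complex_inner)"
  using cinner_scaleC_left[of "-1" x y] by (simp add: scaleC_minus_one)

lemma cinner_minus_right: "cinner x (- y) = - cinner x (y :: 'a::complex_inner)"
  using cinner_scaleC_right[of x "-1" y] by (simp add: scaleC_minus_one)

lemma cinner_diff_left: "cinner (x - y) z = cinner x z - cinner y (z :: 'a::complex_inner)"
  using cinner_add_left[of x "- y" z] by (simp add: cinner_minus_left)

lemma cinner_diff_right: "cinner x (y - z) = cinner x y - cinner x (z :: 'a::complex_inner)"
  using cinner_add_right[of x y "- z"] by (simp add: cinner_minus_right)

lemma Im_cinner: "Im (cinner x y) = inner (- (\<i> *\<^sub>C x)) (y :: 'a::complex_inner)"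
  by (simp add: inner_eq_Re_cinner cinner_scaleC_left cinner_minus_left)

text \<open>Lifts adjoint identities from the real to the complex inner product: an imaginary part
  is a real inner product with the first argument rotated by \<open>- \<i>\<close>, and the second
  hypothesis says that \<open>f\<close> commutes with this rotation.\<close>

lemma cinner_eq_by_inner:
  fixes f :: "'a::complex_inner \<Rightarrow> 'b::complex_inner"
  assumes "\<And>x. inner (f x) y = inner x z" and "f (- (\<i> *\<^sub>C x)) = - (\<i> *\<^sub>C f x)"
  shows "cinner (f x) y = cinner x z"
proof (rule complex_eqI)
  show "Re (cinner (f x) y) = Re (cinner x z)"
    using assms(1) by (simp only: inner_eq_Re_cinner)
  show "Im (cinner (f x) y) = Im (cinner x z)"
    unfolding Im_cinner assms(1)[symmetric] assms(2) ..
qed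

lemma norm_scaleC: "norm (c *\<^sub>C (x :: 'a::complex_inner)) = cmod c * norm x"
proof -
  have "cinner (c *\<^sub>C x) (c *\<^sub>C x) = (c * cnj c) * cinner x x"
    by (simp add: cinner_scaleC_left cinner_scaleC_right)
  then have "(norm (c *\<^sub>C x))\<^sup>2 = Re ((c * cnj c) * cinner x x)"
    by (simp only: power2_norm_eq_inner inner_eq_Re_cinner)
  also have "\<dots> = (cmod c * norm x)\<^sup>2"
    by (simp add: complex_mult_cnj cmod_power2 power_mult_distrib power2_norm_eq_inner inner_eq_Re_cinner)
  finally show ?thesis by (simp add: power2_eq_iff_nonneg)
qed

lemma bounded_linear_scaleC: "bounded_linear (\<lambda>x::'a::complex_inner. c *\<^sub>C x)"
proof (rule bounded_linear_intro)
  fix x y :: 'a and r :: real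
  show "c *\<^sub>C (x + y) = c *\<^sub>C x + c *\<^sub>C y" by (rule scaleC_add_right)
  show "c *\<^sub>C (r *\<^sub>R x) = r *\<^sub>R (c *\<^sub>C x)" by (simp add: scaleR_scaleC scaleC_scaleC mult.commute)
  show "norm (c *\<^sub>C x) \<le> norm x * cmod c" by (simp add: norm_scaleC mult.commute)
qed

lemma scaleC_diff_right: "c *\<^sub>C (x - y) = c *\<^sub>C x - c *\<^sub>C (y :: 'a::complex_inner)"
  using bounded_linear_scaleC[THEN bounded_linear.linear] by (rule linear_diff)

lemma bounded_ops_add: "T \<in> bounded_ops \<Longrightarrow> T (x + y) = T x + T y"
  and bounded_ops_diff: "T \<in> bounded_ops \<Longrightarrow> T (x - y) = T x - T y"
  and bounded_ops_scaleC: "T \<in> bounded_ops \<Longrightarrow> T (c *\<^sub>C x) = c *\<^sub>C T x"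
  by (auto simp: bounded_ops_def linear_simps)

lemma bounded_ops_minus: "T \<in> bounded_ops \<Longrightarrow> T (- x) = - T x"
  by (simp add: bounded_ops_def linear_simps)

lemma bounded_ops_compose: "T \<in> bounded_ops \<Longrightarrow> S \<in> bounded_ops \<Longrightarrow> T \<circ> S \<in> bounded_ops"
  by (auto simp: bounded_ops_def comp_def intro: bounded_linear_compose)

section \<open>The Hilbert space adjoint\<close>

lemma cadjoint_unique:
  fixes T U :: "'h::chilbert_space \<Rightarrow> 'h"
  assumes "\<And>x y. inner (T x) y = inner x (U y)" "\<And>x y. inner (T x) y = inner x (V y)"
  shows "U = V"
proof
  fix y
  have "inner x (U y - V y) = 0" for x
    using assms[of x y] by (simp add: inner_diff_right)
  from this[of "U y - V y"] show "U y = V y" by simp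
qed

text \<open>Riesz gives \<open>U y\<close> as the vector representing the functional that sends
  \<open>x\<close> to \<open>inner (T x) y\<close>. Nondegeneracy makes \<open>U\<close> complex
  linear, and testing \<open>U y\<close> against itself shows that any bound for \<open>T\<close>
  also bounds \<open>U\<close>.\<close>

lemma cadjoint_ex:
  fixes T :: "'h::chilbert_space \<Rightarrow> 'h"
  assumes T: "T \<in> bounded_ops"
  shows "\<exists>U. U \<in> bounded_ops \<and> (\<forall>x y. cinner (T x) y = cinner x (U y))"
proof -
  interpret T: bounded_linear T using T by (simp add: bounded_ops_def)
  have "\<exists>a. \<forall>x. inner (T x) y = inner x a" for y
  proof -
    have "bounded_linear (\<lambda>x. inner (T x) y)"
      by (rule bounded_linear_compose[OF bounded_linear_inner_left T.bounded_linear_axioms])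
    then obtain a where "\<And>v. v \<in> UNIV \<Longrightarrow> inner (T v) y = inner a v"
      using riesz_representation_on_subspace[of "\<lambda>x. inner (T x) y" UNIV] by (auto simp: subspace_UNIV)
    then show ?thesis by (metis UNIV_I inner_commute)
  qed
  then obtain U where U: "\<And>x y. inner (T x) y = inner x (U y)" by metis
  have ad: "cinner (T x) y = cinner x (U y)" for x y
    by (rule cinner_eq_by_inner[of T, OF U])
      (simp add: bounded_ops_minus[OF T] bounded_ops_scaleC[OF T])
  have ext: "u = v" if "\<And>x. cinner x u = cinner x v" for u v :: 'h
  proof -
    have "inner (u - v) (u - v) = 0" using that
      by (simp add: inner_eq_Re_cinner cinner_diff_right)
    then show ?thesis by simp
  qed
  have add: "U (x + y) = U x + U y" for x y
    by (rule ext) (simp add: ad[symmetric] cinner_add_right)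
  have sc: "U (c *\<^sub>C x) = c *\<^sub>C U x" for c x
    by (rule ext) (simp add: ad[symmetric] cinner_scaleC_right)
  obtain K where K: "\<And>x. norm (T x) \<le> norm x * K" using T.bounded by blast
  have "norm (U y) \<le> norm y * K" for y
  proof (cases "U y = 0")
    \<comment> \<open>The sign of \<open>K\<close> is unknown, so the right side is seen to be
      nonnegative through \<open>norm (T y)\<close>.\<close>
    case True
    then show ?thesis using K[of y] norm_ge_zero[of "T y"] by (simp del: norm_ge_zero)
  next
    case False
    have "norm (U y) * norm (U y) = inner (T (U y)) y"
      by (simp add: U power2_norm_eq_inner flip: power2_eq_square)
    also have "\<dots> \<le> norm (T (U y)) * norm y" by (rule norm_cauchy_schwarz)
    also have "\<dots> \<le> (norm (U y) * K) * norm y" by (rule mult_right_mono[OF K]) simp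
    finally have "norm (U y) * norm (U y) \<le> norm (U y) * (norm y * K)" by (simp add: mult_ac)
    then show ?thesis using False by simp
  qed
  then have "bounded_linear U"
    by (intro bounded_linear_intro[where K = K] add) (auto simp: scaleR_scaleC sc)
  then show ?thesis using sc ad by (auto simp: bounded_ops_def)
qed

lemma
  fixes T :: "'h::chilbert_space \<Rightarrow> 'h"
  assumes "T \<in> bounded_ops"
  shows cadjoint_bounded_ops: "cadjoint T \<in> bounded_ops"
    and cinner_cadjoint: "cinner (T x) y = cinner x (cadjoint T y)"
proof -
  have "\<exists>!U. U \<in> bounded_ops \<and> (\<forall>x y. cinner (T x) y = cinner x (U y))"
    using cadjoint_ex[OF assms]
  proof (rule ex_ex1I)
    fix U V :: "'h \<Rightarrow> 'h"
    assume "U \<in> bounded_ops \<and> (\<forall>x y. cinner (T x) y = cinner x (U y))"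
      and "V \<in> bounded_ops \<and> (\<forall>x y. cinner (T x) y = cinner x (V y))"
    then show "U = V"
      by (intro cadjoint_unique[of T]; metis inner_eq_Re_cinner)
  qed
  from theI'[OF this, folded cadjoint_def]
  show "cadjoint T \<in> bounded_ops" "cinner (T x) y = cinner x (cadjoint T y)" by blast+
qed

lemma scaleC_minus_left: "(- c) *\<^sub>C x = - (c *\<^sub>C (x :: 'a::complex_inner))"
  using scaleC_scaleC[of "-1" c x] by (simp add: scaleC_minus_one)

lemma linear_combination_bounded_ops: "T \<in> bounded_ops \<Longrightarrow> S \<in> bounded_ops \<Longrightarrow>
    (\<lambda>x. c *\<^sub>C T x + d *\<^sub>C S x) \<in> bounded_ops"
  unfolding bounded_ops_def
  by (auto intro!: bounded_linear_add bounded_linear_compose[OF bounded_linear_scaleC]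
      simp: scaleC_add_right scaleC_scaleC mult.commute)

lemma subspace_closure:
  fixes V :: "'a::real_normed_vector set"
  assumes V: "subspace V"
  shows "subspace (closure V)"
  unfolding subspace_def
proof (intro conjI ballI allI)
  show "0 \<in> closure V" using subspace_0[OF V] closure_subset by blast
next
  fix x y assume "x \<in> closure V" "y \<in> closure V"
  then obtain f g where "\<And>n. f n \<in> V" "f \<longlonglongrightarrow> x" "\<And>n. g n \<in> V" "g \<longlonglongrightarrow> y"
    by (auto simp: closure_sequential)
  then have "\<And>n. f n + g n \<in> V" "(\<lambda>n. f n + g n) \<longlonglongrightarrow> x + y"
    by (auto intro: subspace_add[OF V] tendsto_add)
  then show "x + y \<in> closure V"
    unfolding closure_sequential by (intro exI[of _ "\<lambda>n. f n + g n"]) blast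
next
  fix c :: real and x assume "x \<in> closure V"
  then obtain f where "\<And>n. f n \<in> V" "f \<longlonglongrightarrow> x" by (auto simp: closure_sequential)
  then have "\<And>n. c *\<^sub>R f n \<in> V" "(\<lambda>n. c *\<^sub>R f n) \<longlonglongrightarrow> c *\<^sub>R x"
    by (auto intro: subspace_scale[OF V] tendsto_scaleR)
  then show "c *\<^sub>R x \<in> closure V"
    unfolding closure_sequential by (intro exI[of _ "\<lambda>n. c *\<^sub>R f n"]) blast
qed

text \<open>Log-convexity makes the successive ratios nondecreasing, so \<open>a\<close> grows at
  least geometrically with ratio \<open>a 1 / a 0\<close>. The exponential bound then forces this
  ratio to be at most \<open>K\<close>, whatever the constant \<open>C\<close>.\<close>

lemma log_convex_growth:
  fixes a :: "nat \<Rightarrow> real"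
  assumes nonneg: "\<And>n. 0 \<le> a n"
    and convex: "\<And>n. (a (Suc n))\<^sup>2 \<le> a n * a (Suc (Suc n))"
    and bound: "\<And>n. a n \<le> C * K ^ n" and "0 < K"
  shows "a 1 \<le> K * a 0"
proof (cases "a 1 = 0")
  case True
  then show ?thesis using nonneg[of 0] \<open>0 < K\<close> by simp
next
  case False
  \<comment> \<open>Positivity of \<open>a 1\<close> propagates in both directions through
    \<open>convex\<close>, which makes the later divisions legitimate.\<close>
  have pos': "0 < a n \<and> 0 < a (Suc n)" for n
  proof (induction n)
    case 0
    have "0 < a 1" using False nonneg[of 1] by simp
    moreover from this have "0 < a 0 * a 2" using convex[of 0]
      by (metis One_nat_def Suc_1 order_less_le_trans zero_less_power)
    ultimately show ?case using nonneg[of 0] by (simp add: zero_less_mult_iff)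
  next
    case (Suc n)
    then have "0 < a n * a (Suc (Suc n))" using convex[of n]
      by (meson order_less_le_trans zero_less_power)
    then show ?case using Suc by (simp add: zero_less_mult_iff)
  qed
  then have pos: "0 < a n" for n by blast
  have step: "a 1 * a n \<le> a 0 * a (Suc n)" for n
  proof (induction n)
    case (Suc n)
    have "a n * (a 1 * a (Suc n)) = (a 1 * a n) * a (Suc n)" by simp
    also have "\<dots> \<le> (a 0 * a (Suc n)) * a (Suc n)" by (rule mult_right_mono[OF Suc nonneg])
    also have "\<dots> = a 0 * (a (Suc n))\<^sup>2" by (simp add: power2_eq_square)
    also have "\<dots> \<le> a 0 * (a n * a (Suc (Suc n)))" by (rule mult_left_mono[OF convex nonneg])
    finally have "a n * (a 1 * a (Suc n)) \<le> a n * (a 0 * a (Suc (Suc n)))" by (simp add: mult_ac)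
    then show ?case using pos[of n] by simp
  qed simp
  \<comment> \<open>\<open>r\<close> compares the initial ratio with \<open>K\<close>; its powers
    stay below \<open>C / a 0\<close>, which excludes \<open>r > 1\<close>.\<close>
  define r where "r = a 1 / (K * a 0)"
  have r: "a 1 = r * (K * a 0)" and "0 < r" using pos[of 0] pos[of 1] \<open>0 < K\<close> by (simp_all add: r_def)
  have grow: "a 0 * (r * K) ^ n \<le> a n" for n
  proof (induction n)
    case (Suc n)
    have "a 0 * (a 0 * (r * K) ^ Suc n) = a 1 * (a 0 * (r * K) ^ n)"
      unfolding r by simp
    also have "\<dots> \<le> a 1 * a n" by (rule mult_left_mono[OF Suc nonneg])
    also have "\<dots> \<le> a 0 * a (Suc n)" by (rule step)
    finally show ?case using pos[of 0] by simp
  qed simp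
  have "r ^ n \<le> C / a 0" for n
  proof -
    have "(a 0 * r ^ n) * K ^ n \<le> C * K ^ n"
      using order_trans[OF grow bound, of n] by (simp add: power_mult_distrib mult_ac)
    then have "a 0 * r ^ n \<le> C" using \<open>0 < K\<close> by simp
    then show ?thesis using pos[of 0] by (simp add: field_simps)
  qed
  then have "r \<le> 1" by (meson not_le real_arch_pow)
  then have "r * (K * a 0) \<le> 1 * (K * a 0)"
    using pos[of 0] \<open>0 < K\<close> by (intro mult_right_mono) auto
  then show ?thesis by (simp only: r mult_1)
qed

section \<open>The semi-inner product of a positive operator\<close>

locale positive_operator =
  fixes A :: "'h::chilbert_space \<Rightarrow> 'h"
  assumes positive: "positive_op A"
begin

abbreviation ip :: "'h \<Rightarrow> 'h \<Rightarrow> complex" where "ip \<equiv> A_inner A"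
abbreviation nm :: "'h \<Rightarrow> real" where "nm \<equiv> A_norm A"

lemma A_bounded_ops: "A \<in> bounded_ops"
  using positive by (simp add: positive_op_def)

sublocale A: bounded_linear A
  using A_bounded_ops by (simp add: bounded_ops_def)

lemma ip_self_nonneg: "ip x x \<in> \<real>\<^sub>\<ge>\<^sub>0"
  using positive by (simp add: positive_op_def A_inner_def)

lemma ip_add_left: "ip (x + y) z = ip x z + ip y z"
  and ip_add_right: "ip z (x + y) = ip z x + ip z y"
  and ip_diff_left: "ip (x - y) z = ip x z - ip y z"
  and ip_diff_right: "ip z (x - y) = ip z x - ip z y"
  and ip_scaleC_left: "ip (c *\<^sub>C x) y = c * ip x y"
  and ip_scaleC_right: "ip x (c *\<^sub>C y) = cnj c * ip x y"
  by (simp_all add: A_inner_def A.add A.diff bounded_ops_scaleC[OF A_bounded_ops] cinner_add_left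
      cinner_add_right cinner_diff_left cinner_diff_right cinner_scaleC_left cinner_scaleC_right)

lemmas ip_simps = ip_add_left ip_add_right ip_diff_left ip_diff_right ip_scaleC_left ip_scaleC_right

lemma Im_ip_self [simp]: "Im (ip x x) = 0"
  using ip_self_nonneg[of x] by (auto simp: complex_nonneg_Reals_iff)

text \<open>Over the complex scalars a form that is real on the diagonal is Hermitian: the diagonal
  at \<open>x + y\<close> settles the imaginary part, the one at \<open>\<i> *\<^sub>C x + y\<close>
  the real part. Self-adjointness of \<open>A\<close> follows.\<close>

lemma ip_commute: "ip x y = cnj (ip y x)"
proof (rule complex_eqI)
  show "Im (ip x y) = Im (cnj (ip y x))"
    using Im_ip_self[of "x + y"] by (simp add: ip_add_left ip_add_right)
  show "Re (ip x y) = Re (cnj (ip y x))"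
    using Im_ip_self[of "\<i> *\<^sub>C x + y"] by (simp add: ip_simps)
qed

lemma cinner_A_right: "cinner x (A y) = ip x y"
  by (subst ip_commute, subst cinner_commute) (simp add: A_inner_def)

lemma nm_nonneg [simp]: "0 \<le> nm x"
  using ip_self_nonneg[of x] by (auto simp: A_norm_def complex_nonneg_Reals_iff)

lemma nm_sq: "(nm x)\<^sup>2 = Re (ip x x)"
  using ip_self_nonneg[of x] by (auto simp: A_norm_def complex_nonneg_Reals_iff)

lemma ip_self: "ip x x = of_real ((nm x)\<^sup>2)"
  by (rule complex_eqI) (simp_all add: nm_sq)

lemma nm_scaleC: "nm (c *\<^sub>C x) = cmod c * nm x"
proof -
  have "ip (c *\<^sub>C x) (c *\<^sub>C x) = (c * cnj c) * ip x x" by (simp add: ip_simps)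
  also have "\<dots> = of_real ((cmod c * nm x)\<^sup>2)"
    by (simp add: ip_self complex_norm_square[symmetric] power_mult_distrib)
  finally have "(nm (c *\<^sub>C x))\<^sup>2 = (cmod c * nm x)\<^sup>2" by (simp only: nm_sq Re_complex_of_real)
  then show ?thesis by (simp add: power2_eq_iff_nonneg)
qed

lemma nm_sq_add_scaleC:
  "(nm (x + of_real t *\<^sub>C y))\<^sup>2 = (nm x)\<^sup>2 + 2 * t * Re (ip x y) + t\<^sup>2 * (nm y)\<^sup>2"
proof -
  have "Re (ip y x) = Re (ip x y)" by (subst ip_commute) simp
  then show ?thesis
    unfolding nm_sq power2_eq_square[of t] by (simp add: ip_simps algebra_simps)
qed

text \<open>Cauchy-Schwarz for a possibly degenerate form. If either vector is null, the expansion
  of the squared seminorm has no constant term, so its linear coefficient vanishes.\<close>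

lemma Re_ip_le: "Re (ip x y) \<le> nm x * nm y"
proof (cases "nm x = 0")
  case True
  have "Re (ip x y) = 0"
  proof (rule quadratic_nonneg_imp_linear_zero[where c = "(nm y)\<^sup>2"])
    fix t show "0 \<le> t\<^sup>2 * (nm y)\<^sup>2 + 2 * t * Re (ip x y)"
      using nm_sq_add_scaleC[of x t y] True zero_le_power2[of "nm (x + of_real t *\<^sub>C y)"]
      by simp
  qed simp
  then show ?thesis using True by simp
next
  case False
  show ?thesis
  proof (cases "nm y = 0")
    case True
    have "Re (ip x y) = Re (ip y x)" by (subst ip_commute) simp
    also have "\<dots> = 0"
    proof (rule quadratic_nonneg_imp_linear_zero[where c = "(nm x)\<^sup>2"])
      fix t show "0 \<le> t\<^sup>2 * (nm x)\<^sup>2 + 2 * t * Re (ip y x)"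
        using nm_sq_add_scaleC[of y t x] True zero_le_power2[of "nm (y + of_real t *\<^sub>C x)"]
        by simp
    qed simp
    finally show ?thesis using True by simp
  next
    case y: False
    have pos: "0 < nm x" "0 < nm y" using False y by (simp_all add: less_le)
    \<comment> \<open>The coefficient \<open>- nm x / nm y\<close> scales \<open>y\<close> to the
      seminorm of \<open>x\<close>, so that the expansion factors.\<close>
    have "0 \<le> (nm x)\<^sup>2 + 2 * (- nm x / nm y) * Re (ip x y) + (- nm x / nm y)\<^sup>2 * (nm y)\<^sup>2"
      unfolding nm_sq_add_scaleC[symmetric] by simp
    also have "\<dots> = 2 * (nm x / nm y) * (nm x * nm y - Re (ip x y))"
      using y by (simp add: field_simps power2_eq_square)
    finally have "0 \<le> (2 * (nm x / nm y)) * (nm x * nm y - Re (ip x y))" .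
    moreover have "0 < 2 * (nm x / nm y)" using pos by simp
    ultimately have "0 \<le> nm x * nm y - Re (ip x y)" using zero_le_mult_iff by (metis not_less)
    then show ?thesis by simp
  qed
qed

lemma cmod_ip_le: "cmod (ip x y) \<le> nm x * nm y"
proof (cases "ip x y = 0")
  case False
  \<comment> \<open>A phase that rotates \<open>ip x y\<close> onto the positive real axis.\<close>
  define c where "c = cnj (ip x y) / cmod (ip x y)"
  have c: "cmod c = 1" using False by (simp add: c_def norm_divide)
  have "c * ip x y = cmod (ip x y)"
    using False by (simp add: c_def mult.commute[of "cnj _"] complex_norm_square[symmetric] power2_eq_square)
  then have "cmod (ip x y) = Re (ip (c *\<^sub>C x) y)" by (simp add: ip_simps)
  also have "\<dots> \<le> nm (c *\<^sub>C x) * nm y" by (rule Re_ip_le)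
  finally show ?thesis by (simp add: nm_scaleC c)
qed simp

lemma nm_le_norm: obtains C where "0 \<le> C" and "\<And>x. nm x \<le> C * norm x"
proof -
  obtain K where "0 \<le> K" and K: "\<And>x. norm (A x) \<le> norm x * K"
    using A.nonneg_bounded by blast
  have "nm x \<le> sqrt K * norm x" for x
  proof -
    have "(nm x)\<^sup>2 = inner (A x) x" by (simp add: nm_sq A_inner_def inner_eq_Re_cinner)
    also have "\<dots> \<le> norm (A x) * norm x" by (rule norm_cauchy_schwarz)
    also have "\<dots> \<le> norm x * K * norm x" by (rule mult_right_mono[OF K]) simp
    finally have "(nm x)\<^sup>2 \<le> (sqrt K * norm x)\<^sup>2"
      using \<open>0 \<le> K\<close>
      by (simp add: power_mult_distrib power2_eq_square[of "norm x"] mult_ac)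
    then show ?thesis by (rule power2_le_imp_le) (simp add: \<open>0 \<le> K\<close>)
  qed
  then show ?thesis using \<open>0 \<le> K\<close> by (intro that[of "sqrt K"]) auto
qed

text \<open>\<open>M = U \<circ> T\<close> is symmetric for the semi-inner product, so
  \<open>\<parallel>M\<^sup>n x\<parallel>\<^sub>A\<close> is log-convex in \<open>n\<close>, while it grows at most like
  \<open>\<parallel>M\<parallel>\<^sup>n\<close>.\<close>

lemma seminorm_bounded_if_adjoint:
  assumes T: "T \<in> bounded_ops" and U: "U \<in> bounded_ops"
    and ad: "\<And>x y. ip (T x) y = ip x (U y)"
  obtains c where "0 \<le> c" and "\<And>x. nm (T x) \<le> c * nm x"
proof -
  define M where "M = U \<circ> T"
  have "bounded_linear M" unfolding M_def using bounded_ops_compose[OF U T] by (simp add: bounded_ops_def)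
  then obtain K where "0 < K" and K: "\<And>x. norm (M x) \<le> norm x * K"
    using bounded_linear.pos_bounded by blast
  have TT: "ip (T x) (T y) = ip x (M y)" for x y by (simp add: ad M_def)
  have sym: "ip (M x) y = ip x (M y)" for x y
    by (metis TT ip_commute)
  obtain C where "0 \<le> C" and C: "\<And>x. nm x \<le> C * norm x" using nm_le_norm by blast
  have M_le: "nm (M x) \<le> K * nm x" for x
  proof -
    define a where "a n = nm ((M ^^ n) x)" for n
    have pow: "norm ((M ^^ n) x) \<le> norm x * K ^ n" for n
    proof (induction n)
      case (Suc n)
      have "norm ((M ^^ Suc n) x) \<le> norm ((M ^^ n) x) * K" using K by simp
      also have "\<dots> \<le> norm x * K ^ n * K" by (rule mult_right_mono[OF Suc]) (use \<open>0 < K\<close> in simp)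
      finally show ?case by (simp add: mult_ac)
    qed simp
    have "a 1 \<le> K * a 0"
    proof (rule log_convex_growth[where C = "C * norm x"])
      fix n
      show "0 \<le> a n" by (simp add: a_def)
      have "(a (Suc n))\<^sup>2 = Re (ip ((M ^^ n) x) (M (M ((M ^^ n) x))))"
        by (simp add: a_def nm_sq sym)
      also have "\<dots> \<le> a n * a (Suc (Suc n))" using Re_ip_le by (simp add: a_def)
      finally show "(a (Suc n))\<^sup>2 \<le> a n * a (Suc (Suc n))" .
      have "a n \<le> C * norm ((M ^^ n) x)" by (simp add: a_def C)
      also have "\<dots> \<le> C * (norm x * K ^ n)" by (rule mult_left_mono[OF pow \<open>0 \<le> C\<close>])
      finally show "a n \<le> C * norm x * K ^ n" by (simp add: mult_ac)
    qed (rule \<open>0 < K\<close>)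
    then show ?thesis by (simp add: a_def)
  qed
  \<comment> \<open>The squared seminorm of \<open>T x\<close> is the quadratic form of
    \<open>M\<close> at \<open>x\<close>; hence the square root of the bound for
    \<open>M\<close>.\<close>
  have "nm (T x) \<le> sqrt K * nm x" for x
  proof -
    have "(nm (T x))\<^sup>2 = Re (ip x (M x))" by (simp add: nm_sq TT)
    also have "\<dots> \<le> nm x * nm (M x)" by (rule Re_ip_le)
    also have "\<dots> \<le> nm x * (K * nm x)" by (rule mult_left_mono[OF M_le]) simp
    finally have "(nm (T x))\<^sup>2 \<le> (sqrt K * nm x)\<^sup>2"
      using \<open>0 < K\<close> by (simp add: power_mult_distrib mult.left_commute flip: power2_eq_square)
    then show ?thesis by (rule power2_le_imp_le) (use \<open>0 < K\<close> in simp)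
  qed
  then show ?thesis using \<open>0 < K\<close> by (intro that[of "sqrt K"]) auto
qed

section \<open>Existence and uniqueness of the \<open>A\<close>-adjoint\<close>

lemma closure_range_orthogonal:
  assumes "u \<in> closure (range A)" and "A u = 0"
  shows "u = 0"
proof -
  \<comment> \<open>By self-adjointness the kernel of \<open>A\<close> is orthogonal to its range.
    Thus \<open>u\<close> is orthogonal to a closed set containing \<open>u\<close> itself.\<close>
  have "range A \<subseteq> {v. inner u v = 0}"
  proof safe
    fix v
    have "inner u (A v) = inner (A u) v" by (simp add: inner_eq_Re_cinner cinner_A_right A_inner_def)
    then show "inner u (A v) = 0" using assms(2) by simp
  qed
  moreover have "closed {v. inner u v = 0}" by (intro closed_Collect_eq continuous_intros)
  ultimately have "inner u u = 0" using closure_minimal assms(1) by blast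
  then show ?thesis by simp
qed

lemma subspace_closure_range: "subspace (closure (range A))"
  by (intro subspace_closure linear_subspace_image A.linear_axioms subspace_UNIV)

lemma scaleC_closure_range:
  assumes "u \<in> closure (range A)" shows "c *\<^sub>C u \<in> closure (range A)"
proof -
  have "(\<lambda>v. c *\<^sub>C v) ` closure (range A) \<subseteq> closure ((\<lambda>v. c *\<^sub>C v) ` range A)"
    by (intro closure_bounded_linear_image_subset bounded_linear_scaleC)
  also have "\<dots> \<subseteq> closure (range A)"
    by (intro closure_mono) (auto simp flip: bounded_ops_scaleC[OF A_bounded_ops])
  finally show ?thesis using assms by blast
qed

text \<open>\<open>u\<close> is the orthogonal projection of \<open>z\<close> onto the closed range,
  obtained by representing \<open>inner z\<close> there. The difference \<open>u - z\<close> is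
  orthogonal to \<open>range A\<close> and is therefore killed by the self-adjoint
  \<open>A\<close>.\<close>

lemma A_preimage_in_closure_range:
  obtains u where "u \<in> closure (range A)" and "A u = A z"
proof -
  obtain u where u: "u \<in> closure (range A)"
    and eq: "\<And>v. v \<in> closure (range A) \<Longrightarrow> inner z v = inner u v"
    using riesz_representation_on_subspace[OF bounded_linear_inner_right subspace_closure_range closed_closure]
    by blast
  have "A (u - z) = 0"
  proof -
    have "inner (A (u - z)) v = inner (u - z) (A v)" for v
      by (simp add: inner_eq_Re_cinner cinner_A_right A_inner_def)
    also have "inner (u - z) (A v) = 0" for v
      using eq[OF subsetD[OF closure_subset rangeI]] by (simp add: inner_diff_left)
    finally have "inner (A (u - z)) (A (u - z)) = 0" .
    then show ?thesis by simp
  qed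
  then show ?thesis using u that by (simp add: A.diff)
qed

text \<open>A case of Douglas's range inclusion theorem. Preimages under \<open>A\<close> are chosen
  pointwise in the closure of the range; injectivity of \<open>A\<close> there makes the choice
  linear and unique, and the Baire argument makes it bounded.\<close>

lemma A_adj_ex1:
  assumes "T \<in> A_adjointable A"
  shows "\<exists>!X. X \<in> bounded_ops \<and> A \<circ> X = cadjoint T \<circ> A \<and> range X \<subseteq> closure (range A)"
proof (rule ex_ex1I)
  have T: "T \<in> bounded_ops" and ran: "range (cadjoint T \<circ> A) \<subseteq> range A"
    using assms by (auto simp: A_adjointable_def)
  note ad = cinner_cadjoint[OF T] and T'ops = cadjoint_bounded_ops[OF T]
  have "\<exists>u \<in> closure (range A). A u = cadjoint T (A x)" for x
  proof -
    obtain z where "cadjoint T (A x) = A z" using ran by fastforce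
    then show ?thesis using A_preimage_in_closure_range[of z] by metis
  qed
  then obtain X where Xcl: "\<And>x. X x \<in> closure (range A)"
    and AX: "\<And>x. A (X x) = cadjoint T (A x)" by metis
  have eqI: "u = v" if "u \<in> closure (range A)" "v \<in> closure (range A)" "A u = A v" for u v
    using closure_range_orthogonal[of "u - v"] that subspace_diff[OF subspace_closure_range]
    by (simp add: A.diff)
  have add: "X (x + y) = X x + X y" for x y
    by (rule eqI) (simp_all add: Xcl subspace_add[OF subspace_closure_range] AX A.add
        bounded_ops_add[OF T'ops])
  have sc: "X (c *\<^sub>C x) = c *\<^sub>C X x" for c x
    by (rule eqI) (simp_all add: Xcl scaleC_closure_range AX
        bounded_ops_scaleC[OF T'ops] bounded_ops_scaleC[OF A_bounded_ops])
  have lin: "linear X" by (rule linearI) (simp_all add: add sc scaleR_scaleC)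
  have X_A: "inner (X x) (A v) = inner x (A (T v))" for x v
  proof -
    have "cinner (X x) (A v) = cinner (cadjoint T (A x)) v"
      by (simp add: cinner_A_right A_inner_def AX)
    also have "\<dots> = cnj (cinner (T v) (A x))" by (subst cinner_commute) (simp add: ad)
    also have "\<dots> = cinner (A x) (T v)" by (subst cinner_commute) simp
    also have "\<dots> = cinner x (A (T v))" by (simp add: cinner_A_right A_inner_def)
    finally show ?thesis by (simp add: inner_eq_Re_cinner)
  qed
  \<comment> \<open>\<open>\<parallel>X x\<parallel> \<le> r\<close> can be tested against \<open>range A\<close>, whose closure contains
    \<open>X x\<close>, and \<open>\<lambda>x. inner (X x) (A v)\<close> is continuous.\<close>
  have sublevel: "{x. norm (X x) \<le> r} = {x. \<forall>v. \<bar>inner x (A (T v))\<bar> \<le> r * norm (A v)}"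
    if "0 \<le> r" for r
  proof (intro equalityI subsetI CollectI allI; drule CollectD)
    fix x v assume "norm (X x) \<le> r"
    then have "norm (X x) * norm (A v) \<le> r * norm (A v)" by (rule mult_right_mono) simp
    then show "\<bar>inner x (A (T v))\<bar> \<le> r * norm (A v)"
      using Cauchy_Schwarz_ineq2[of "X x" "A v"] by (simp add: X_A)
  next
    fix x assume *: "\<forall>v. \<bar>inner x (A (T v))\<bar> \<le> r * norm (A v)"
    have "range A \<subseteq> {u. inner (X x) u \<le> r * norm u}"
      using * by (auto simp: X_A intro: order_trans[OF abs_ge_self])
    moreover have "closed {u. inner (X x) u \<le> r * norm u}"
      by (intro closed_Collect_le continuous_intros)
    ultimately have "inner (X x) (X x) \<le> r * norm (X x)" using closure_minimal Xcl by blast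
    then have "norm (X x) * norm (X x) \<le> r * norm (X x)"
      by (simp add: power2_norm_eq_inner flip: power2_eq_square)
    then show "norm (X x) \<le> r" using that by (cases "X x = 0") auto
  qed
  have "bounded_linear X"
  proof (rule linear_bounded_if_sublevels_closed[OF lin])
    fix n :: nat
    show "closed {x. norm (X x) \<le> real n}"
      unfolding sublevel[OF of_nat_0_le_iff] by (intro closed_Collect_all closed_Collect_le continuous_intros)
  qed
  then show "\<exists>X. X \<in> bounded_ops \<and> A \<circ> X = cadjoint T \<circ> A \<and> range X \<subseteq> closure (range A)"
    using sc AX Xcl by (intro exI[of _ X]) (auto simp: bounded_ops_def)
  fix Y Z
  assume Y: "Y \<in> bounded_ops \<and> A \<circ> Y = cadjoint T \<circ> A \<and> range Y \<subseteq> closure (range A)"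
    and Z: "Z \<in> bounded_ops \<and> A \<circ> Z = cadjoint T \<circ> A \<and> range Z \<subseteq> closure (range A)"
  show "Y = Z"
  proof
    fix x show "Y x = Z x"
    proof (rule eqI)
      have "A \<circ> Y = A \<circ> Z" using Y Z by simp
      then show "A (Y x) = A (Z x)" by (simp add: fun_eq_iff)
    qed (use Y Z in auto)
  qed
qed

lemma
  assumes "T \<in> A_adjointable A"
  shows A_adj_bounded_ops: "A_adj A T \<in> bounded_ops"
    and ip_A_adj: "ip (T x) y = ip x (A_adj A T y)"
proof -
  have T: "T \<in> bounded_ops" using assms by (simp add: A_adjointable_def)
  note X = theI'[OF A_adj_ex1[OF assms], folded A_adj_def]
  then show "A_adj A T \<in> bounded_ops" by blast
  have "ip (T x) y = cinner (T x) (A y)" by (simp add: cinner_A_right)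
  also have "\<dots> = cinner x (cadjoint T (A y))" by (rule cinner_cadjoint[OF T])
  also have "cadjoint T (A y) = A (A_adj A T y)" using X by (metis comp_apply)
  finally show "ip (T x) y = ip x (A_adj A T y)" by (simp add: cinner_A_right)
qed

subsection \<open>Seminorm bounds\<close>

text \<open>The operators for which the sets in \<open>A_opnorm\<close> and
  \<open>A_numradius\<close> are bounded above, so that the suprema are meaningful.\<close>

definition A_bounded :: "('h \<Rightarrow> 'h) \<Rightarrow> bool"
  where "A_bounded B \<longleftrightarrow> B \<in> bounded_ops \<and> (\<exists>c. \<forall>x. nm (B x) \<le> c * nm x)"

lemma A_bounded_nonneg:
  assumes "A_bounded B"
  obtains c where "0 \<le> c" and "\<And>x. nm (B x) \<le> c * nm x"
proof -
  obtain c where c: "\<And>x. nm (B x) \<le> c * nm x" using assms by (auto simp: A_bounded_def)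
  have "nm (B x) \<le> \<bar>c\<bar> * nm x" for x
    using c[of x] mult_right_mono[OF abs_ge_self nm_nonneg, of c x] by linarith
  then show ?thesis by (intro that[of "\<bar>c\<bar>"]) auto
qed

lemma nm_triangle: "nm (x + y) \<le> nm x + nm y"
proof (rule power2_le_imp_le)
  have "(nm (x + y))\<^sup>2 = (nm x)\<^sup>2 + (nm y)\<^sup>2 + 2 * Re (ip x y)"
    using ip_commute[of y x] by (simp add: nm_sq ip_simps)
  then show "(nm (x + y))\<^sup>2 \<le> (nm x + nm y)\<^sup>2"
    using Re_ip_le[of x y] by (simp add: power2_sum)
qed simp

lemma A_bounded_linear_combination:
  assumes "A_bounded B" "A_bounded D"
  shows "A_bounded (\<lambda>x. c *\<^sub>C B x + d *\<^sub>C D x)"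
proof -
  obtain b where b: "0 \<le> b" "\<And>x. nm (B x) \<le> b * nm x" using assms(1) A_bounded_nonneg by blast
  obtain e where e: "0 \<le> e" "\<And>x. nm (D x) \<le> e * nm x" using assms(2) A_bounded_nonneg by blast
  have "nm (c *\<^sub>C B x + d *\<^sub>C D x) \<le> (cmod c * b + cmod d * e) * nm x" for x
  proof -
    have "nm (c *\<^sub>C B x + d *\<^sub>C D x) \<le> cmod c * nm (B x) + cmod d * nm (D x)"
      using nm_triangle[of "c *\<^sub>C B x" "d *\<^sub>C D x"] by (simp add: nm_scaleC)
    also have "\<dots> \<le> cmod c * (b * nm x) + cmod d * (e * nm x)"
      by (intro add_mono mult_left_mono b e norm_ge_zero)
    finally show ?thesis by (simp add: algebra_simps)
  qed
  then show ?thesis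
    using assms by (auto simp: A_bounded_def intro: linear_combination_bounded_ops)
qed

lemma A_bounded_if_adjoint:
  assumes "T \<in> bounded_ops" "U \<in> bounded_ops" "\<And>x y. ip (T x) y = ip x (U y)"
  shows "A_bounded T"
  using seminorm_bounded_if_adjoint[OF assms] assms(1) unfolding A_bounded_def by metis

lemma nm_normalized:
  assumes "nm x \<noteq> 0"
  obtains u where "nm u = 1" and "x = of_real (nm x) *\<^sub>C u"
proof (rule that)
  show "nm (of_real (1 / nm x) *\<^sub>C x) = 1" using assms by (simp add: nm_scaleC norm_divide)
  show "x = of_real (nm x) *\<^sub>C of_real (1 / nm x) *\<^sub>C x"
    using assms by (simp add: scaleC_scaleC scaleC_one)
qed

lemma
  assumes "A_bounded B"
  shows A_opnorm_nonneg: "0 \<le> A_opnorm A B"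
    and nm_le_opnorm: "nm (B x) \<le> A_opnorm A B * nm x"
proof -
  obtain c where c: "0 \<le> c" "\<And>x. nm (B x) \<le> c * nm x" using assms A_bounded_nonneg by blast
  have "y \<le> c" if "y \<in> insert 0 {nm (B x) | x. nm x = 1}" for y
    using that c(1) c(2) by (auto simp: dest: sym) (metis c(2) mult_1_right)
  then have bdd: "bdd_above (insert 0 {nm (B x) | x. nm x = 1})" by (rule bdd_aboveI)
  show "0 \<le> A_opnorm A B" unfolding A_opnorm_def by (rule cSup_upper[OF _ bdd]) simp
  show "nm (B x) \<le> A_opnorm A B * nm x"
  proof (cases "nm x = 0")
    \<comment> \<open>Null vectors cannot be normalised; the bound by \<open>c\<close> shows that
      \<open>B\<close> sends them to null vectors.\<close>
    case True
    then show ?thesis using c(2)[of x] by simp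
  next
    case False
    then obtain u where u: "nm u = 1" and x: "x = of_real (nm x) *\<^sub>C u" by (rule nm_normalized)
    have "nm (B u) \<le> A_opnorm A B"
      unfolding A_opnorm_def by (rule cSup_upper[OF _ bdd]) (use u in auto)
    then have "nm (B u) * nm x \<le> A_opnorm A B * nm x" by (rule mult_right_mono) simp
    moreover have "nm (B x) = nm (B u) * nm x"
      using assms by (subst x) (simp add: A_bounded_def bounded_ops_scaleC nm_scaleC)
    ultimately show ?thesis by simp
  qed
qed

lemma A_opnorm_le:
  assumes "0 \<le> c" and "\<And>x. nm (B x) \<le> c * nm x"
  shows "A_opnorm A B \<le> c"
  unfolding A_opnorm_def
proof (rule cSup_least)
  fix y assume "y \<in> insert 0 {nm (B x) | x. nm x = 1}"
  then show "y \<le> c" using assms(1) by auto (metis assms(2) mult_1_right)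
qed simp

lemma
  assumes "A_bounded B"
  shows A_numradius_nonneg: "0 \<le> A_numradius A B"
    and cmod_ip_le_numradius: "cmod (ip (B x) x) \<le> A_numradius A B * (nm x)\<^sup>2"
proof -
  obtain c where c: "0 \<le> c" "\<And>x. nm (B x) \<le> c * nm x" using assms A_bounded_nonneg by blast
  have le: "cmod (ip (B x) x) \<le> c * (nm x)\<^sup>2" for x
    using order_trans[OF cmod_ip_le mult_right_mono[OF c(2) nm_nonneg], of x x]
    by (simp add: power2_eq_square mult.assoc)
  have "y \<le> c" if "y \<in> insert 0 {cmod (ip (B x) x) | x. nm x = 1}" for y
    using that c(1) by auto (metis le mult_1_right one_power2)
  then have bdd: "bdd_above (insert 0 {cmod (ip (B x) x) | x. nm x = 1})" by (rule bdd_aboveI)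
  show "0 \<le> A_numradius A B" unfolding A_numradius_def by (rule cSup_upper[OF _ bdd]) simp
  show "cmod (ip (B x) x) \<le> A_numradius A B * (nm x)\<^sup>2"
  proof (cases "nm x = 0")
    case True
    then show ?thesis using le[of x] by simp
  next
    case False
    then obtain u where u: "nm u = 1" and x: "x = of_real (nm x) *\<^sub>C u" by (rule nm_normalized)
    have "cmod (ip (B u) u) \<le> A_numradius A B"
      unfolding A_numradius_def by (rule cSup_upper[OF _ bdd]) (use u in auto)
    then have "cmod (ip (B u) u) * (nm x)\<^sup>2 \<le> A_numradius A B * (nm x)\<^sup>2"
      by (rule mult_right_mono) simp
    moreover have "cmod (ip (B x) x) = cmod (ip (B u) u) * (nm x)\<^sup>2"
      using assms by (subst (1 2) x)
        (simp add: A_bounded_def bounded_ops_scaleC ip_simps norm_mult power2_eq_square)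
    ultimately show ?thesis by simp
  qed
qed

lemma A_numradius_le:
  assumes "0 \<le> c" and "\<And>x. nm x = 1 \<Longrightarrow> cmod (ip (B x) x) \<le> c"
  shows "A_numradius A B \<le> c"
  unfolding A_numradius_def by (rule cSup_least) (use assms in auto)

text \<open>Polarisation: \<open>4 Re \<langle>B x, y\<rangle>\<^sub>A\<close> is the difference of the quadratic form at
  \<open>x + y\<close> and \<open>x - y\<close>; take \<open>y\<close> to be the multiple of \<open>B x\<close> with the seminorm of \<open>x\<close>.\<close>

lemma opnorm_selfadjoint_le:
  assumes B: "A_bounded B" and sym: "\<And>x y. ip (B x) y = ip x (B y)"
    and "0 \<le> w" and w: "\<And>x. \<bar>Re (ip (B x) x)\<bar> \<le> w * (nm x)\<^sup>2"
  shows "A_opnorm A B \<le> w"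
proof (rule A_opnorm_le[OF \<open>0 \<le> w\<close>])
  fix x
  show "nm (B x) \<le> w * nm x"
  proof (cases "nm (B x) = 0")
    case True
    then show ?thesis using \<open>0 \<le> w\<close> by simp
  next
    case False
    \<comment> \<open>A null \<open>x\<close> would have a null image under the
      \<open>A\<close>-bounded \<open>B\<close>.\<close>
    have "nm x \<noteq> 0" using False nm_le_opnorm[OF B, of x] nm_nonneg[of "B x"] by (auto simp del: nm_nonneg)
    then have pos: "0 < nm x" "0 < nm (B x)" using False by (simp_all add: less_le)
    define y where "y = of_real (nm x / nm (B x)) *\<^sub>C B x"
    have ny: "nm y = nm x" using pos by (simp add: y_def nm_scaleC norm_divide)
    have Bops: "B \<in> bounded_ops" using B by (simp add: A_bounded_def)
    have com: "Re (ip (B y) x) = Re (ip (B x) y)" by (metis sym ip_commute complex_cnj_cancel_iff cnj.sel(1))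
    have "4 * (nm x * nm (B x)) = 4 * Re (ip (B x) y)"
      using pos by (simp add: y_def ip_simps ip_self power2_eq_square field_simps)
    also have "\<dots> = Re (ip (B (x + y)) (x + y)) - Re (ip (B (x - y)) (x - y))"
      using com by (simp add: bounded_ops_add[OF Bops] bounded_ops_diff[OF Bops] ip_simps)
    also have "\<dots> \<le> w * (nm (x + y))\<^sup>2 + w * (nm (x - y))\<^sup>2"
      using w[of "x + y"] w[of "x - y"] by linarith
    also have "\<dots> = w * (2 * (nm x)\<^sup>2 + 2 * (nm y)\<^sup>2)"
      by (simp add: nm_sq ip_simps algebra_simps)
    also have "\<dots> = 4 * (nm x * (w * nm x))" by (simp add: ny power2_eq_square)
    finally have "nm x * nm (B x) \<le> nm x * (w * nm x)" by simp
    then show ?thesis using pos by simp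
  qed
qed

section \<open>Seminorm estimates for \<open>A\<close>-adjointable operators and their
  commutators\<close>

lemma A_adjointable_bounded:
  assumes "T \<in> A_adjointable A"
  shows "A_bounded T" and "A_bounded (A_adj A T)"
proof -
  have T: "T \<in> bounded_ops" using assms by (simp add: A_adjointable_def)
  note X = A_adj_bounded_ops[OF assms] and ad = ip_A_adj[OF assms]
  show "A_bounded T" using T X ad by (rule A_bounded_if_adjoint)
  \<comment> \<open>Conjugate symmetry exchanges the roles of \<open>T\<close> and its
    \<open>A\<close>-adjoint, so the log-convexity bound applies to both.\<close>
  have "ip (A_adj A T x) y = ip x (T y)" for x y
    using ad[of y x] by (subst ip_commute) (simp add: ip_commute[of x])
  with X T show "A_bounded (A_adj A T)" by (rule A_bounded_if_adjoint)
qed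

text \<open>The squared seminorm of \<open>A_adj A S x\<close> equals the form of
  \<open>S (A_adj A S x)\<close> against \<open>x\<close>; after Cauchy-Schwarz one factor
  cancels.\<close>

lemma nm_A_adj_le:
  assumes S: "S \<in> A_adjointable A"
  shows "nm (A_adj A S x) \<le> A_opnorm A S * nm x"
proof (cases "nm (A_adj A S x) = 0")
  case True
  then show ?thesis using A_opnorm_nonneg[OF A_adjointable_bounded(1)[OF S]] by simp
next
  case False
  have "nm (A_adj A S x) * nm (A_adj A S x) = Re (ip (S (A_adj A S x)) x)"
    by (simp add: ip_A_adj[OF S] nm_sq flip: power2_eq_square)
  also have "\<dots> \<le> nm (S (A_adj A S x)) * nm x" by (rule Re_ip_le)
  also have "\<dots> \<le> (A_opnorm A S * nm (A_adj A S x)) * nm x"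
    by (intro mult_right_mono nm_le_opnorm A_adjointable_bounded S nm_nonneg)
  finally have "nm (A_adj A S x) * nm (A_adj A S x) \<le> nm (A_adj A S x) * (A_opnorm A S * nm x)"
    by (simp add: mult_ac)
  then show ?thesis using False by (simp add: less_le)
qed

text \<open>The constant \<open>k\<close> is left open because both parts of the theorem use this
  estimate, each with its own \<open>k\<close>. Bounding the sum of the two moduli handles both
  signs at once.\<close>

lemma numradius_commutators_le:
  assumes T: "T \<in> A_adjointable A" and S: "S \<in> A_adjointable A"
    and k: "\<And>x. (nm (T x))\<^sup>2 + (nm (A_adj A T x))\<^sup>2 \<le> k * (nm x)\<^sup>2" and "0 \<le> k"
  shows "A_numradius A (\<lambda>x. T (S x) + S (T x)) \<le> A_opnorm A S * sqrt (2 * k)"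
    and "A_numradius A (\<lambda>x. T (S x) - S (T x)) \<le> A_opnorm A S * sqrt (2 * k)"
proof -
  note s0 = A_opnorm_nonneg[OF A_adjointable_bounded(1)[OF S]]
  then have nonneg: "0 \<le> A_opnorm A S * sqrt (2 * k)" using \<open>0 \<le> k\<close> by simp
  have *: "cmod (ip (T (S x)) x) + cmod (ip (S (T x)) x) \<le> A_opnorm A S * sqrt (2 * k)"
    if "nm x = 1" for x
  proof -
    let ?a = "nm (T x)" and ?b = "nm (A_adj A T x)"
    have "cmod (ip (T (S x)) x) \<le> nm (S x) * ?b"
      by (simp add: ip_A_adj[OF T] cmod_ip_le)
    also have "\<dots> \<le> A_opnorm A S * ?b"
      using nm_le_opnorm[OF A_adjointable_bounded(1)[OF S], of x] that
      by (intro mult_right_mono) simp_all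
    finally have 1: "cmod (ip (T (S x)) x) \<le> A_opnorm A S * ?b" .
    have "cmod (ip (S (T x)) x) \<le> ?a * nm (A_adj A S x)"
      by (simp add: ip_A_adj[OF S] cmod_ip_le)
    also have "\<dots> \<le> ?a * A_opnorm A S"
      using nm_A_adj_le[OF S, of x] that by (intro mult_left_mono) simp_all
    finally have 2: "cmod (ip (S (T x)) x) \<le> A_opnorm A S * ?a" by (simp add: mult.commute)
    have "(?a + ?b)\<^sup>2 \<le> 2 * (?a\<^sup>2 + ?b\<^sup>2)"
      using zero_le_power2[of "?a - ?b"] by (simp add: power2_eq_square algebra_simps)
    also have "\<dots> \<le> 2 * k" using k[of x] that by simp
    finally have "?a + ?b \<le> sqrt (2 * k)" by (rule real_le_rsqrt)
    then have "A_opnorm A S * (?a + ?b) \<le> A_opnorm A S * sqrt (2 * k)" by (rule mult_left_mono[OF _ s0])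
    then show ?thesis using 1 2 by (simp add: distrib_left)
  qed
  show "A_numradius A (\<lambda>x. T (S x) + S (T x)) \<le> A_opnorm A S * sqrt (2 * k)"
    by (rule A_numradius_le[OF nonneg], unfold ip_add_left)
      (rule order_trans[OF norm_triangle_ineq *])
  show "A_numradius A (\<lambda>x. T (S x) - S (T x)) \<le> A_opnorm A S * sqrt (2 * k)"
    by (rule A_numradius_le[OF nonneg], unfold ip_diff_left)
      (rule order_trans[OF norm_triangle_ineq4 *])
qed

section \<open>Real and imaginary parts with respect to \<open>A\<close>\<close>

context
  fixes T assumes T: "T \<in> A_adjointable A"
begin

lemma ip_A_adj_left: "ip (A_adj A T x) y = ip x (T y)"
  by (subst ip_commute, subst ip_A_adj[OF T, symmetric], subst ip_commute) simp

lemma A_bounded_parts: "A_bounded (A_Re A T)" "A_bounded (A_Im A T)"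
proof -
  note combination = A_bounded_linear_combination[OF A_adjointable_bounded[OF T]]
  show "A_bounded (A_Re A T)"
    using combination[of "1 / 2" "1 / 2"] by (simp add: A_Re_def scaleC_add_right)
  show "A_bounded (A_Im A T)"
    using combination[of "1 / (2 * \<i>)" "- (1 / (2 * \<i>))"]
    unfolding A_Im_def by (simp only: scaleC_diff_right scaleC_minus_left add_uminus_conv_diff)
qed

lemma ip_parts_selfadjoint:
  "ip (A_Re A T x) y = ip x (A_Re A T y)" "ip (A_Im A T x) y = ip x (A_Im A T y)"
  by (simp_all add: A_Re_def A_Im_def ip_simps ip_A_adj_left ip_A_adj[OF T] field_simps)

lemma ip_parts_self:
  "ip (A_Re A T x) x = of_real (Re (ip (T x) x))" "ip (A_Im A T x) x = of_real (Im (ip (T x) x))"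
proof -
  have "ip (A_adj A T x) x = cnj (ip (T x) x)" by (subst ip_commute) (simp add: ip_A_adj[OF T])
  then show "ip (A_Re A T x) x = of_real (Re (ip (T x) x))" "ip (A_Im A T x) x = of_real (Im (ip (T x) x))"
    by (simp_all add: A_Re_def A_Im_def ip_simps complex_eq_iff)
qed

text \<open>With \<open>P\<close> and \<open>Q\<close> the real and imaginary parts,
  \<open>T\<close> and its \<open>A\<close>-adjoint are \<open>P + \<i>Q\<close> and
  \<open>P - \<i>Q\<close>. The first identity is the parallelogram law for them; applied to
  \<open>P + Q\<close> and \<open>P - Q\<close> the law has the same right side.\<close>

lemma nm_sq_parts:
  "(nm (T x))\<^sup>2 + (nm (A_adj A T x))\<^sup>2 = 2 * ((nm (A_Re A T x))\<^sup>2 + (nm (A_Im A T x))\<^sup>2)"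
  "(nm (T x))\<^sup>2 + (nm (A_adj A T x))\<^sup>2
    = (nm (A_Re A T x + A_Im A T x))\<^sup>2 + (nm (A_Re A T x - A_Im A T x))\<^sup>2"
  by (simp_all add: nm_sq A_Re_def A_Im_def ip_simps algebra_simps)

text \<open>The quadratic forms of the two parts are the real and imaginary parts of
  \<open>ip (T x) x\<close>, each bounded by its modulus.\<close>

lemma opnorm_parts_le:
  "A_opnorm A (A_Re A T) \<le> A_numradius A T" "A_opnorm A (A_Im A T) \<le> A_numradius A T"
proof -
  note w = A_numradius_nonneg[OF A_adjointable_bounded(1)[OF T]]
    and le = cmod_ip_le_numradius[OF A_adjointable_bounded(1)[OF T]]
  show "A_opnorm A (A_Re A T) \<le> A_numradius A T"
    using order_trans[OF abs_Re_le_cmod le]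
    by (intro opnorm_selfadjoint_le A_bounded_parts ip_parts_selfadjoint w) (simp add: ip_parts_self)
  show "A_opnorm A (A_Im A T) \<le> A_numradius A T"
    using order_trans[OF abs_Im_le_cmod le]
    by (intro opnorm_selfadjoint_le A_bounded_parts ip_parts_selfadjoint w) (simp add: ip_parts_self)
qed

lemma A_bounded_sum_diff_parts:
  "A_bounded (\<lambda>x. A_Re A T x + A_Im A T x)" "A_bounded (\<lambda>x. A_Re A T x - A_Im A T x)"
  using A_bounded_linear_combination[OF A_bounded_parts, of 1 1]
    A_bounded_linear_combination[OF A_bounded_parts, of 1 "- 1"]
  by (simp_all add: scaleC_one scaleC_minus_one)

text \<open>The factor \<open>sqrt 2\<close> comes from comparing the sum of the absolute real and
  imaginary parts of a complex number with its modulus.\<close>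

lemma opnorm_sum_diff_parts_le:
  "A_opnorm A (\<lambda>x. A_Re A T x + A_Im A T x) \<le> sqrt 2 * A_numradius A T"
  "A_opnorm A (\<lambda>x. A_Re A T x - A_Im A T x) \<le> sqrt 2 * A_numradius A T"
proof -
  note w = A_numradius_nonneg[OF A_adjointable_bounded(1)[OF T]]
  have le: "\<bar>Re (ip (T x) x)\<bar> + \<bar>Im (ip (T x) x)\<bar> \<le> sqrt 2 * A_numradius A T * (nm x)\<^sup>2" for x
  proof -
    have "cmod (ip (T x) x) \<le> A_numradius A T * (nm x)\<^sup>2"
      by (rule cmod_ip_le_numradius[OF A_adjointable_bounded(1)[OF T]])
    then have "sqrt 2 * cmod (ip (T x) x) \<le> sqrt 2 * A_numradius A T * (nm x)\<^sup>2"
      by (simp add: mult.assoc)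
    then show ?thesis by (rule order_trans[OF complex_abs_le_norm])
  qed
  show "A_opnorm A (\<lambda>x. A_Re A T x + A_Im A T x) \<le> sqrt 2 * A_numradius A T"
  proof (intro opnorm_selfadjoint_le A_bounded_sum_diff_parts)
    show "\<bar>Re (ip (A_Re A T x + A_Im A T x) x)\<bar> \<le> sqrt 2 * A_numradius A T * (nm x)\<^sup>2" for x
      using le[of x] by (simp add: ip_add_left ip_parts_self)
  qed (simp_all add: w ip_simps ip_parts_selfadjoint)
  show "A_opnorm A (\<lambda>x. A_Re A T x - A_Im A T x) \<le> sqrt 2 * A_numradius A T"
  proof (intro opnorm_selfadjoint_le A_bounded_sum_diff_parts)
    show "\<bar>Re (ip (A_Re A T x - A_Im A T x) x)\<bar> \<le> sqrt 2 * A_numradius A T * (nm x)\<^sup>2" for x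
      using le[of x] by (simp add: ip_diff_left ip_parts_self)
  qed (simp_all add: w ip_simps ip_parts_selfadjoint)
qed

text \<open>These supply the two values of \<open>k\<close> for
  \<open>numradius_commutators_le\<close>.\<close>

lemma nm_sq_sum_le_parts:
  "(nm (T x))\<^sup>2 + (nm (A_adj A T x))\<^sup>2
    \<le> 2 * ((A_opnorm A (A_Re A T))\<^sup>2 + (A_opnorm A (A_Im A T))\<^sup>2) * (nm x)\<^sup>2"
  and nm_sq_sum_le_sum_diff_parts:
  "(nm (T x))\<^sup>2 + (nm (A_adj A T x))\<^sup>2
    \<le> ((A_opnorm A (\<lambda>x. A_Re A T x + A_Im A T x))\<^sup>2
        + (A_opnorm A (\<lambda>x. A_Re A T x - A_Im A T x))\<^sup>2) * (nm x)\<^sup>2"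
proof -
  have sq: "(nm (B x))\<^sup>2 \<le> (A_opnorm A B)\<^sup>2 * (nm x)\<^sup>2" if "A_bounded B" for B
    using power_mono[OF nm_le_opnorm[OF that] nm_nonneg, of x 2] by (simp add: power_mult_distrib)
  show "(nm (T x))\<^sup>2 + (nm (A_adj A T x))\<^sup>2
    \<le> 2 * ((A_opnorm A (A_Re A T))\<^sup>2 + (A_opnorm A (A_Im A T))\<^sup>2) * (nm x)\<^sup>2"
    unfolding nm_sq_parts(1) using add_mono[OF A_bounded_parts[THEN sq]] by (simp add: algebra_simps)
  show "(nm (T x))\<^sup>2 + (nm (A_adj A T x))\<^sup>2
    \<le> ((A_opnorm A (\<lambda>x. A_Re A T x + A_Im A T x))\<^sup>2
        + (A_opnorm A (\<lambda>x. A_Re A T x - A_Im A T x))\<^sup>2) * (nm x)\<^sup>2"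
    unfolding nm_sq_parts(2) using add_mono[OF A_bounded_sum_diff_parts[THEN sq]]
    by (simp add: algebra_simps)
qed

end

end

section \<open>Matching the constants and conclusion\<close>

lemma mult_sqrt_le_two_sqrt_two:
  fixes s k y :: real
  assumes "0 \<le> s" and "k \<le> 4 * y"
  shows "s * sqrt (2 * k) \<le> 2 * sqrt 2 * s * sqrt y"
proof -
  \<comment> \<open>\<open>2 * k\<close> is at most \<open>8 * y\<close>, and the square root of 8
    is \<open>2 * sqrt 2\<close>. The function \<open>sqrt\<close> is monotone and multiplicative on
    all reals, which covers either sign of \<open>y\<close>.\<close>
  have "sqrt (2 * k) \<le> sqrt (2\<^sup>2 * (2 * y))" using assms(2) by simp
  also have "\<dots> = 2 * sqrt 2 * sqrt y"
    unfolding real_sqrt_mult real_sqrt_abs by simp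
  finally have "s * sqrt (2 * k) \<le> s * (2 * sqrt 2 * sqrt y)" using assms(1) by (rule mult_left_mono)
  then show ?thesis by (simp add: mult_ac)
qed

theorem corollary3p3:
  fixes A T S :: "'h::chilbert_space \<Rightarrow> 'h"
  assumes "positive_op A"
    and "T \<in> A_adjointable A"
    and "S \<in> A_adjointable A"
  shows "(A_numradius A (\<lambda>x. T (S x) + S (T x))
            \<le> 2 * sqrt 2 * A_opnorm A S *
               sqrt ((A_numradius A T)\<^sup>2
                 - \<bar>(A_opnorm A (A_Re A T))\<^sup>2 - (A_opnorm A (A_Im A T))\<^sup>2\<bar> / 2)
        \<and> A_numradius A (\<lambda>x. T (S x) - S (T x))
            \<le> 2 * sqrt 2 * A_opnorm A S *
               sqrt ((A_numradius A T)\<^sup>2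
                 - \<bar>(A_opnorm A (A_Re A T))\<^sup>2 - (A_opnorm A (A_Im A T))\<^sup>2\<bar> / 2))
      \<and> (A_numradius A (\<lambda>x. T (S x) + S (T x))
            \<le> 2 * sqrt 2 * A_opnorm A S *
               sqrt ((A_numradius A T)\<^sup>2
                 - \<bar>(A_opnorm A (\<lambda>x. A_Re A T x + A_Im A T x))\<^sup>2
                    - (A_opnorm A (\<lambda>x. A_Re A T x - A_Im A T x))\<^sup>2\<bar> / 4)
        \<and> A_numradius A (\<lambda>x. T (S x) - S (T x))
            \<le> 2 * sqrt 2 * A_opnorm A S *
               sqrt ((A_numradius A T)\<^sup>2
                 - \<bar>(A_opnorm A (\<lambda>x. A_Re A T x + A_Im A T x))\<^sup>2
                    - (A_opnorm A (\<lambda>x. A_Re A T x - A_Im A T x))\<^sup>2\<bar> / 4))"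
proof -
  interpret positive_operator A by (rule positive_operator.intro) (rule assms(1))
  note T = assms(2) and S = assms(3)
  let ?w = "A_numradius A T"
  let ?p = "A_opnorm A (A_Re A T)" and ?q = "A_opnorm A (A_Im A T)"
  let ?u = "A_opnorm A (\<lambda>x. A_Re A T x + A_Im A T x)"
  let ?v = "A_opnorm A (\<lambda>x. A_Re A T x - A_Im A T x)"
  note s = A_opnorm_nonneg[OF A_adjointable_bounded(1)[OF S]]
  have pq: "?p\<^sup>2 \<le> ?w\<^sup>2" "?q\<^sup>2 \<le> ?w\<^sup>2"
    by (intro power_mono opnorm_parts_le A_opnorm_nonneg A_bounded_parts T)+
  have uv: "?u\<^sup>2 \<le> 2 * ?w\<^sup>2" "?v\<^sup>2 \<le> 2 * ?w\<^sup>2"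
    using power_mono[OF opnorm_sum_diff_parts_le(1)[OF T] A_opnorm_nonneg[OF A_bounded_sum_diff_parts(1)[OF T]], of 2]
      power_mono[OF opnorm_sum_diff_parts_le(2)[OF T] A_opnorm_nonneg[OF A_bounded_sum_diff_parts(2)[OF T]], of 2]
    by (simp_all add: power_mult_distrib)
  note i = numradius_commutators_le[OF T S nm_sq_sum_le_parts[OF T]]
    and ii = numradius_commutators_le[OF T S nm_sq_sum_le_sum_diff_parts[OF T]]
  \<comment> \<open>Both rest on a + b = 2 max(a, b) - |a - b|. The maximum is at most
    \<open>?w\<^sup>2\<close> for the squares of \<open>?p\<close> and \<open>?q\<close>, and at
    most twice that for \<open>?u\<close> and \<open>?v\<close>.\<close>
  have k1: "2 * (?p\<^sup>2 + ?q\<^sup>2) \<le> 4 * (?w\<^sup>2 - \<bar>?p\<^sup>2 - ?q\<^sup>2\<bar> / 2)"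
    and k2: "?u\<^sup>2 + ?v\<^sup>2 \<le> 4 * (?w\<^sup>2 - \<bar>?u\<^sup>2 - ?v\<^sup>2\<bar> / 4)"
    using pq uv by (simp_all add: abs_if)
  \<comment> \<open>The last \<open>simp\<close> discharges the nonnegativity of \<open>k\<close>, a
    sum of squares in both cases.\<close>
  show ?thesis
    by (intro conjI; rule order_trans[OF _ mult_sqrt_le_two_sqrt_two[OF s k1]]
        order_trans[OF _ mult_sqrt_le_two_sqrt_two[OF s k2]]; rule i ii; simp)
qed

end
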